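(* Every additive function $H:\mathbb{R}\to\mathbb{R}$ is bilaterally $\mathbb{Q}$-continuous.
   Context: A function $H:\mathbb{R}\to\mathbb{R}$ is additive if $H(x+y)=H(x)+H(y)$ for all $x,y\in\mathbb{R}$. For real $y\neq z$ put $S(y,z)=\{qy+(1-q)z: q\in\mathbb{Q}\cap[0,1]\}$. A function $f:\mathbb{R}\to\mathbb{R}$ is bilaterally $\mathbb{Q}$-continuous if for every $x\in\mathbb{R}$ there is $\epsilon>0$ such that for all $y,z$ with $x-\epsilon\le y<z\le x+\epsilon$ there is a continuous (in the usual sense) function $f_{y,z}:[y,z]\to\mathbb{R}$ with $f_{y,z}(t)=f(t)$ for all $t\in S(y,z)$. *)

theory Defs
  imports Complex_Main
begin

definition rat_segment :: "real \<Rightarrow> real \<Rightarrow> real set" where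
  "rat_segment y z = {q * y + (1 - q) * z | q. q \<in> \<rat> \<inter> {0..1}}"

(* A function on the closed interval from y to z is represented by a total function g
   of which only the restriction to {y..z} matters. *)
definition bilaterally_rat_continuous :: "(real \<Rightarrow> real) \<Rightarrow> bool" where
  "bilaterally_rat_continuous f \<longleftrightarrow>
     (\<forall>x. \<exists>\<epsilon>>0. \<forall>y z. x - \<epsilon> \<le> y \<and> y < z \<and> z \<le> x + \<epsilon> \<longrightarrow>
        (\<exists>g :: real \<Rightarrow> real. continuous_on {y..z} g \<and> (\<forall>t\<in>rat_segment y z. g t = f t)))"

end

theory Submission
  imports Defs
begin

text \<open>An additive function is \<open>\<rat>\<close>-linear, because additivity determines its values at
  integer multiples and, by clearing denominators, at rational multiples of a point.  On
  \<open>rat_segment y z\<close> it therefore coincides with the chord through \<open>(y, H y)\<close> and \<open>(z, H z)\<close>,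
  however wild it is elsewhere.  The chord is affine, hence continuous, and it exists for all
  \<open>y < z\<close>, so every choice of \<open>\<epsilon>\<close> works at every point.\<close>

lemma additive_of_nat_mult:
  fixes H :: "real \<Rightarrow> real"
  assumes "Modules.additive H"
  shows "H (of_nat n * x) = of_nat n * H x"
proof -
  interpret additive H by fact
  show ?thesis by (induction n) (simp_all add: zero add algebra_simps)
qed

lemma additive_of_int_mult:
  fixes H :: "real \<Rightarrow> real"
  assumes "Modules.additive H"
  shows "H (of_int k * x) = of_int k * H x"
proof -
  interpret additive H by fact
  show ?thesis
    by (cases k rule: int_cases2) (simp_all add: minus additive_of_nat_mult[OF assms])
qed

text \<open>Multiplying \<open>q * x\<close> by the denominator of \<open>q\<close> turns it into an integer multiple of \<open>x\<close>;
  the denominator can then be cancelled among the values of \<open>H\<close>.\<close>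

lemma additive_Rats_mult:
  fixes H :: "real \<Rightarrow> real"
  assumes H: "Modules.additive H" and q: "q \<in> \<rat>"
  shows "H (q * x) = q * H x"
proof -
  from q obtain a :: int and b :: nat where b: "b \<noteq> 0" and q_eq: "q = of_int a / of_nat b"
    by (auto simp: Rats_eq_int_div_nat)
  have "of_nat b * H (q * x) = H (of_nat b * (q * x))"
    by (simp only: additive_of_nat_mult[OF H])
  also have "of_nat b * (q * x) = of_int a * x"
    using b by (simp add: q_eq)
  also have "H (of_int a * x) = of_int a * H x"
    by (rule additive_of_int_mult[OF H])
  finally show ?thesis
    using b by (simp add: q_eq field_simps)
qed

text \<open>The rational weight \<open>q\<close> of a point \<open>t\<close> of the segment is recovered from \<open>t\<close> as the quotient
  \<open>(t - z) / (y - z)\<close>.  This expression makes sense for every real \<open>t\<close>, which is what extends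
  the interpolation formula to a function on the whole interval.\<close>

lemma additive_eq_chord_on_rat_segment:
  fixes H :: "real \<Rightarrow> real"
  assumes H: "Modules.additive H" and yz: "y \<noteq> z" and t: "t \<in> rat_segment y z"
  shows "H t = H z + (t - z) / (y - z) * (H y - H z)"
proof -
  interpret additive H by fact
  from t obtain q where q: "q \<in> \<rat>" and t_eq: "t = q * y + (1 - q) * z"
    by (auto simp: rat_segment_def)
  have "H t = q * H y + (1 - q) * H z"
    using q by (simp add: t_eq add additive_Rats_mult[OF H])
  moreover have "(t - z) / (y - z) = q"
    using yz by (simp add: t_eq field_simps)
  ultimately show ?thesis
    by (simp add: algebra_simps)
qed

theorem theorem4p7:
  fixes H :: "real \<Rightarrow> real"
  assumes "Modules.additive H"
  shows "bilaterally_rat_continuous H"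
proof -
  have "\<exists>g. continuous_on {y..z} g \<and> (\<forall>t\<in>rat_segment y z. g t = H t)" if "y < z" for y z
  proof (intro exI conjI ballI)
    let ?chord = "\<lambda>t. H z + (t - z) / (y - z) * (H y - H z)"
    show "continuous_on {y..z} ?chord"
      using that by (intro continuous_intros) auto
    show "?chord t = H t" if "t \<in> rat_segment y z" for t
      using additive_eq_chord_on_rat_segment[OF assms _ that] \<open>y < z\<close> by simp
  qed
  then show ?thesis
    unfolding bilaterally_rat_continuous_def by (meson zero_less_one)
qed

end
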